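(* For any $C>0$, there exists an edge-ordered tree $H$ with order chromatic number two such that $\mathrm{ex}_<(n,H)= \Omega\left(n2^{C\sqrt{\log n}}\right)$; that is, there exist $c>0$ and $n_0$ such that $\mathrm{ex}_<(n,H)\ge c\,n2^{C\sqrt{\log n}}$ for all integers $n\ge n_0$.
   Context: An edge-ordered graph is a finite simple graph $G=(V,E)$ with a linear order on its edge set $E$. An isomorphism between edge-ordered graphs must respect the edge-order. A subgraph of an edge-ordered graph is itself an edge-ordered graph with the induced edge-order. An edge-ordered graph $G$ contains another edge-ordered graph $H$ if $H$ is isomorphic to a subgraph of $G$; otherwise $G$ avoids $H$. For a positive integer $n$ and an edge-ordered graph $H$, $\mathrm{ex}_<(n,H)$ is the maximal number of edges in an edge-ordered graph on $n$ vertices that avoids $H$. An edge-ordered tree is an edge-ordered graph whose underlying graph is a tree. The order chromatic number of an edge-ordered graph $H$ with at least one edge is the smallest chromatic number of a finite simple graph $G$ such that every edge-ordering of $G$ contains $H$ (and it is $\infty$ if no such $G$ exists). Here $\log$ is the binary logarithm. *)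

theory Defs
  imports Complex_Main "HOL-Library.Extended_Nat"
begin

record 'a graph =
  verts :: "'a set"
  edges :: "'a set set"

definition simple_graph :: "('a, 'b) graph_scheme \<Rightarrow> bool" where
  "simple_graph G \<longleftrightarrow> finite (verts G) \<and> (\<forall>e\<in>edges G. e \<subseteq> verts G \<and> card e = 2)"

text \<open>An edge-ordered graph carries the reflexive relation of a linear order on its edges:
  \<open>(e, e') \<in> eorder G\<close> means that \<open>e\<close> is at most \<open>e'\<close>.\<close>

record 'a eograph = "'a graph" +
  eorder :: "'a set rel"

definition edge_ordered_graph :: "'a eograph \<Rightarrow> bool" where
  "edge_ordered_graph G \<longleftrightarrow> simple_graph G \<and> linear_order_on (edges G) (eorder G)"

definition eo_subgraph :: "'a eograph \<Rightarrow> 'a eograph \<Rightarrow> bool" where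
  "eo_subgraph K G \<longleftrightarrow> edge_ordered_graph K \<and> verts K \<subseteq> verts G \<and> edges K \<subseteq> edges G
     \<and> eorder K = Restr (eorder G) (edges K)"

definition eo_isomorphic :: "'a eograph \<Rightarrow> 'b eograph \<Rightarrow> bool" where
  "eo_isomorphic G H \<longleftrightarrow> (\<exists>f. bij_betw f (verts G) (verts H)
     \<and> edges H = (\<lambda>e. f ` e) ` edges G
     \<and> (\<forall>e\<in>edges G. \<forall>e'\<in>edges G. (e, e') \<in> eorder G \<longleftrightarrow> (f ` e, f ` e') \<in> eorder H))"

definition eo_contains :: "'a eograph \<Rightarrow> 'b eograph \<Rightarrow> bool" where
  "eo_contains G H \<longleftrightarrow> (\<exists>K. eo_subgraph K G \<and> eo_isomorphic H K)"

text \<open>Here and in \<open>order_chromatic_number\<close>, host graphs have natural numbers as vertices;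
  every finite graph is isomorphic to such a graph. If \<open>H\<close> has at least one edge, then the set
  below is nonempty (and it is always finite), so that the maximum is attained.\<close>

definition ex_lt :: "nat \<Rightarrow> 'a eograph \<Rightarrow> nat" where
  "ex_lt n H = Max {card (edges G) | G :: nat eograph.
     edge_ordered_graph G \<and> card (verts G) = n \<and> \<not> eo_contains G H}"

definition connected_graph :: "('a, 'b) graph_scheme \<Rightarrow> bool" where
  "connected_graph G \<longleftrightarrow> verts G \<noteq> {}
     \<and> (\<forall>u\<in>verts G. \<forall>v\<in>verts G. (u, v) \<in> {(x, y). {x, y} \<in> edges G}\<^sup>*)"

text \<open>A cycle is given by its list of pairwise distinct vertices in cyclic order.\<close>

definition is_cycle :: "('a, 'b) graph_scheme \<Rightarrow> 'a list \<Rightarrow> bool" where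
  "is_cycle G p \<longleftrightarrow> length p \<ge> 3 \<and> distinct p
     \<and> (\<forall>i < length p. {p ! i, p ! (Suc i mod length p)} \<in> edges G)"

definition is_tree :: "('a, 'b) graph_scheme \<Rightarrow> bool" where
  "is_tree G \<longleftrightarrow> simple_graph G \<and> connected_graph G \<and> (\<nexists>p. is_cycle G p)"

definition edge_ordered_tree :: "'a eograph \<Rightarrow> bool" where
  "edge_ordered_tree H \<longleftrightarrow> edge_ordered_graph H \<and> is_tree H"

definition colorable :: "('a, 'b) graph_scheme \<Rightarrow> nat \<Rightarrow> bool" where
  "colorable G k \<longleftrightarrow> (\<exists>c. c ` verts G \<subseteq> {..<k}
     \<and> (\<forall>u\<in>verts G. \<forall>v\<in>verts G. {u, v} \<in> edges G \<longrightarrow> c u \<noteq> c v))"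

definition chromatic_number :: "('a, 'b) graph_scheme \<Rightarrow> nat" where
  "chromatic_number G = (LEAST k. colorable G k)"

text \<open>The infimum in \<^typ>\<open>enat\<close> is a minimum for a nonempty set, and \<open>\<infinity>\<close> for the empty set.\<close>

definition order_chromatic_number :: "'a eograph \<Rightarrow> enat" where
  "order_chromatic_number H = Inf {enat (chromatic_number G) | G :: nat graph.
     simple_graph G \<and>
     (\<forall>r. linear_order_on (edges G) r \<longrightarrow>
        eo_contains \<lparr>verts = verts G, edges = edges G, eorder = r\<rparr> H)}"

end

theory Submission
  imports Defs "HOL-Library.Ramsey"
begin

text \<open>Fix \<open>K\<close>. The vertices of the dense graph are, on one side, \<open>b\<close>-tuples of parallel lines in an
  integer grid with \<open>K\<close> columns and, on the other side, \<open>b\<close>-tuples of grid points; adjacency is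
  coordinatewise incidence, so that every tuple of lines has \<open>K ^ b\<close> neighbours. Edges are compared
  lexicographically, point tuples first. Two facts make this useful in each coordinate: the neighbours
  of a tuple of lines take at most \<open>K\<close> values, and two lines with two common points coincide, so that
  tuples of lines through a common tuple of points share no second value.

  The forbidden tree has two inner rows, the first and the last, joined by a column; each of them has
  one further column, and many leaf rows in between are attached to the three columns cyclically. All
  edges of a row are consecutive. If the rows are mapped to point tuples, then by pigeonhole some two
  leaves of the common column agree in the leading coordinate, hence so does the whole block of rows
  between them, which meets all three columns. By the second fact both inner rows then have the same
  leading coordinate as the block, and by monotonicity all rows have. Inductively, all rows agree in
  all coordinates, which is absurd. The other orientation is impossible since the edges of a column
  would have to be consecutive.

  With \<open>log n\<close> about \<open>2 b\<^sup>2 log K\<close>, the degree \<open>K ^ b\<close> is \<open>2\<close> to the power of about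
  \<open>sqrt (log K / 2) * sqrt (log n)\<close>. The order chromatic number is two because, by Ramsey's theorem for
  quadruples, every edge-ordering of a large complete bipartite graph contains a lexicographically
  ordered one, up to exchanging the sides.\<close>

subsection \<open>Edge-ordered graphs\<close>

text \<open>The image of an embedding, with the restricted order, is the required subgraph.
  Containment is handled only in this form when embedding into hosts and excluding the tree.\<close>

lemma eo_contains_iff:
  assumes G: "edge_ordered_graph G" and H: "edge_ordered_graph H"
  shows "eo_contains G H \<longleftrightarrow> (\<exists>f. inj_on f (verts H) \<and> f ` verts H \<subseteq> verts G
     \<and> (\<forall>e\<in>edges H. f ` e \<in> edges G)
     \<and> (\<forall>e\<in>edges H. \<forall>e'\<in>edges H. (e, e') \<in> eorder H \<longleftrightarrow> (f ` e, f ` e') \<in> eorder G))"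
    (is "_ \<longleftrightarrow> (\<exists>f. ?emb f)")
proof
  assume "eo_contains G H"
  then obtain K where K: "eo_subgraph K G" and "eo_isomorphic H K"
    unfolding eo_contains_def by (elim exE conjE)
  then obtain f where f: "bij_betw f (verts H) (verts K)"
    "edges K = (\<lambda>e. f ` e) ` edges H"
    "\<forall>e\<in>edges H. \<forall>e'\<in>edges H. (e, e') \<in> eorder H \<longleftrightarrow> (f ` e, f ` e') \<in> eorder K"
    unfolding eo_isomorphic_def by (elim exE conjE)
  have "verts K \<subseteq> verts G" "edges K \<subseteq> edges G" "eorder K = Restr (eorder G) (edges K)"
    using K[unfolded eo_subgraph_def] by blast+
  moreover have "inj_on f (verts H)" "f ` verts H = verts K"
    using f(1)[unfolded bij_betw_def] by blast+
  moreover have img: "f ` e \<in> edges K" if "e \<in> edges H" for e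
    using that f(2) by simp
  ultimately have "inj_on f (verts H)" "f ` verts H \<subseteq> verts G" "\<forall>e\<in>edges H. f ` e \<in> edges G"
    "\<forall>e\<in>edges H. \<forall>e'\<in>edges H. (e, e') \<in> eorder H \<longleftrightarrow> (f ` e, f ` e') \<in> eorder G"
    using f(3) by (simp, simp, blast, simp add: img)
  then show "\<exists>f. ?emb f" by blast
next
  assume "\<exists>f. ?emb f"
  then obtain f where inj: "inj_on f (verts H)" and V: "f ` verts H \<subseteq> verts G"
    and fE: "\<forall>e\<in>edges H. f ` e \<in> edges G"
    and ord: "\<forall>e\<in>edges H. \<forall>e'\<in>edges H. (e, e') \<in> eorder H \<longleftrightarrow> (f ` e, f ` e') \<in> eorder G"
    by blast
  define E where "E = (\<lambda>e. f ` e) ` edges H"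
  define K :: "'a eograph"
    where "K = \<lparr>verts = f ` verts H, edges = E, eorder = Restr (eorder G) E\<rparr>"
  have EG: "E \<subseteq> edges G"
    using fE by (auto simp: E_def)
  have sub: "e \<subseteq> verts H" "card e = 2" if "e \<in> edges H" for e
    using H that by (auto simp: edge_ordered_graph_def simple_graph_def)
  have fin: "finite (verts H)"
    using H by (auto simp: edge_ordered_graph_def simple_graph_def)
  have "card (f ` e) = 2" if "e \<in> edges H" for e
    using sub[OF that] inj card_image inj_on_subset by metis
  then have "simple_graph K"
    using sub(1) fin by (simp add: simple_graph_def K_def E_def image_mono)
  moreover have "linear_order_on E (Restr (eorder G) E)"
  proof -
    have lin: "refl_on (edges G) (eorder G)" "trans (eorder G)" "antisym (eorder G)"
        "total_on (edges G) (eorder G)"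
      using G by (simp_all add: edge_ordered_graph_def order_on_defs)
    have "refl_on E (Restr (eorder G) E)"
      using lin(1) EG by (simp add: refl_on_def subset_iff)
    moreover have "total_on E (Restr (eorder G) E)"
      using lin(4) EG by (simp add: total_on_def subset_iff)
    ultimately show ?thesis
      using trans_Restr[OF lin(2)] antisym_Restr[OF lin(3)] by (simp add: order_on_defs)
  qed
  ultimately have "edge_ordered_graph K"
    by (simp add: edge_ordered_graph_def K_def)
  then have "eo_subgraph K G"
    using V EG by (simp add: eo_subgraph_def K_def)
  moreover have "eo_isomorphic H K"
    unfolding eo_isomorphic_def
    using inj ord by (intro exI[of _ f]) (simp add: bij_betw_def K_def E_def)
  ultimately show "eo_contains G H"
    by (auto simp: eo_contains_def)
qed

text \<open>\<open>Max\<close> bounds its elements only over a finite set; here edge sets lie in the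
  power set of \<open>n\<close> vertices, so no count exceeds \<open>2 ^ n\<close>.\<close>

lemma ex_lt_ge:
  fixes G :: "nat eograph"
  assumes "edge_ordered_graph G" "card (verts G) = n" "\<not> eo_contains G H"
  shows "card (edges G) \<le> ex_lt n H"
proof -
  let ?S = "{card (edges G) | G :: nat eograph.
     edge_ordered_graph G \<and> card (verts G) = n \<and> \<not> eo_contains G H}"
  have "card (edges F) \<le> 2 ^ card (verts F)" if "edge_ordered_graph F" for F :: "nat eograph"
  proof -
    have "edges F \<subseteq> Pow (verts F)" "finite (verts F)"
      using that by (auto simp: edge_ordered_graph_def simple_graph_def)
    then show ?thesis
      by (metis card_Pow card_mono finite_Pow_iff)
  qed
  then have "?S \<subseteq> {..2 ^ n}" by auto
  then have "finite ?S" by (rule finite_subset) simp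
  then show ?thesis
    unfolding ex_lt_def by (rule Max_ge) (use assms in blast)
qed

text \<open>When left vertices are numbered below right ones, \<open>Max\<close> and
  \<open>Min\<close> read off the right and left endpoint of an edge, so the order needs no explicit
  bipartition.\<close>

definition lex_order :: "nat set set \<Rightarrow> nat set rel" where
  "lex_order E = {(e, e'). e \<in> E \<and> e' \<in> E \<and> (Max e < Max e' \<or> Max e = Max e' \<and> Min e \<le> Min e')}"

lemma linear_order_lex_order:
  assumes "\<And>e. e \<in> E \<Longrightarrow> card e = 2"
  shows "linear_order_on E (lex_order E)"
proof -
  have "e = {Min e, Max e}" if e: "e \<in> E" for e
  proof -
    obtain a b where "e = {a, b}" using assms[OF e] by (auto simp: card_2_iff)
    then show ?thesis by (auto simp: min_def max_def)
  qed
  then have eq: "e = e'" if "e \<in> E" "e' \<in> E" "Min e = Min e'" "Max e = Max e'" for e e'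
    using that by metis
  have "antisym (lex_order E)"
    by (rule antisymI, rule eq) (auto simp: lex_order_def)
  moreover have "total_on E (lex_order E)"
    unfolding total_on_def lex_order_def by auto
  moreover have "trans (lex_order E)"
    unfolding trans_def lex_order_def by auto
  moreover have "refl_on E (lex_order E)" "lex_order E \<subseteq> E \<times> E"
    unfolding refl_on_def lex_order_def by auto
  ultimately show ?thesis
    unfolding linear_order_on_def partial_order_on_def preorder_on_def by blast
qed

text \<open>The left class is \<open>{..<N}\<close>, the right class \<open>{N..<n}\<close>; edges are compared first by
  their right and then by their left endpoint.\<close>

definition bipartite_graph :: "nat \<Rightarrow> nat \<Rightarrow> (nat \<Rightarrow> nat \<Rightarrow> bool) \<Rightarrow> nat eograph" where
  "bipartite_graph N n P = (let E = {{x, N + y} |x y. x < N \<and> N + y < n \<and> P x y}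
     in \<lparr>verts = {..<n}, edges = E, eorder = lex_order E\<rparr>)"

lemma verts_bipartite_graph [simp]: "verts (bipartite_graph N n P) = {..<n}"
  by (simp add: bipartite_graph_def Let_def)

lemma edges_bipartite_graph:
  "edges (bipartite_graph N n P) = {{x, N + y} |x y. x < N \<and> N + y < n \<and> P x y}"
  by (simp add: bipartite_graph_def Let_def)

lemma edge_bipartite_graph_iff:
  "x < N \<Longrightarrow> {x, N + y} \<in> edges (bipartite_graph N n P) \<longleftrightarrow> N + y < n \<and> P x y"
  by (auto simp: edges_bipartite_graph doubleton_eq_iff)

lemma edge_bipartite_graphE:
  assumes "{u, v} \<in> edges (bipartite_graph N n P)"
  obtains x y where "u = x" "v = N + y" "x < N" "N + y < n" "P x y"
    | x y where "v = x" "u = N + y" "x < N" "N + y < n" "P x y"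
  using assms by (auto simp: edges_bipartite_graph doubleton_eq_iff)

lemma edge_ordered_bipartite_graph: "edge_ordered_graph (bipartite_graph N n P)"
proof -
  have "simple_graph (bipartite_graph N n P)"
    by (auto simp: simple_graph_def edges_bipartite_graph)
  then show ?thesis
    by (auto simp: edge_ordered_graph_def bipartite_graph_def Let_def simple_graph_def
        intro!: linear_order_lex_order)
qed

lemma eorder_bipartite_graph_iff:
  assumes "x < N" "x' < N"
  shows "({x, N + y}, {x', N + y'}) \<in> eorder (bipartite_graph N n P) \<longleftrightarrow>
    N + y < n \<and> N + y' < n \<and> P x y \<and> P x' y' \<and> (y < y' \<or> y = y' \<and> x \<le> x')"
proof -
  have "eorder (bipartite_graph N n P) = lex_order (edges (bipartite_graph N n P))"
    by (simp add: bipartite_graph_def Let_def)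
  moreover have "Max {a, N + b} = N + b" "Min {a, N + b} = a" if "a < N" for a b
    using that by auto
  ultimately show ?thesis
    using assms by (auto simp: lex_order_def edge_bipartite_graph_iff)
qed

subsection \<open>Order chromatic number\<close>

definition row_lex :: "nat \<Rightarrow> (nat \<Rightarrow> nat \<Rightarrow> nat) \<Rightarrow> bool" where
  "row_lex m g \<longleftrightarrow> (\<forall>p<m. \<forall>q<m. \<forall>r<m. \<forall>s<m. p < q \<or> p = q \<and> r < s \<longrightarrow> g p r < g q s)"

lemma row_lexI:
  assumes "\<And>p r s. p < m \<Longrightarrow> r < s \<Longrightarrow> s < m \<Longrightarrow> g p r < g p s"
    and "\<And>p q r. p < q \<Longrightarrow> q < m \<Longrightarrow> r < m \<Longrightarrow> g p r < g q r"
    and "\<And>p q r s. p < q \<Longrightarrow> q < m \<Longrightarrow> r < s \<Longrightarrow> s < m \<Longrightarrow> g p s < g q r"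
  shows "row_lex m g"
  unfolding row_lex_def
proof (intro allI impI)
  fix p q r s assume *: "p < m" "q < m" "r < m" "s < m" "p < q \<or> p = q \<and> r < s"
  consider "p = q" "r < s" | "p < q" "r < s" | "p < q" "r = s" | "p < q" "s < r"
    using * by linarith
  then show "g p r < g q s"
  proof cases
    \<comment> \<open>When both indices increase, the comparison factors through
      \<open>g p s\<close>; so only the opposed case needs its own hypothesis.\<close>
    case 2
    then show ?thesis using assms(1)[of p r s] assms(2)[of p q s] * by simp
  qed (use assms * in auto)
qed

lemma finite_colour_Ramsey:
  "\<exists>N. \<forall>f :: nat set \<Rightarrow> ('c :: finite). \<exists>H c. H \<in> nsets {..<N} m \<and> (\<forall>X\<in>nsets H r. f X = c)"
proof -
  obtain h where h: "bij_betw h (UNIV :: 'c set) {..<card (UNIV :: 'c set)}"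
    using ex_bij_betw_finite_nat[of "UNIV :: 'c set"] by (auto simp: atLeast0LessThan)
  obtain N where N: "partn_lst {..<N :: nat} (replicate (card (UNIV :: 'c set)) m) r"
    using ramsey_full by metis
  have "\<exists>H c. H \<in> nsets {..<N} m \<and> (\<forall>X\<in>nsets H r. f X = c)" for f :: "nat set \<Rightarrow> 'c"
  proof -
    have "h \<circ> f \<in> nsets {..<N} r \<rightarrow> {..<card (UNIV :: 'c set)}"
      using h by (auto simp: bij_betw_def)
    then obtain i H where i: "i < card (UNIV :: 'c set)" and H: "H \<in> nsets {..<N} m"
      "(h \<circ> f) ` nsets H r \<subseteq> {i}"
      using partn_lstE[OF N] by (metis length_replicate nth_replicate)
    have "\<forall>X\<in>nsets H r. f X = inv h i"
      using H(2) h by (auto simp: bij_betw_def inv_f_f)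
    then show ?thesis using H(1) by blast
  qed
  then show ?thesis by blast
qed

text \<open>Quadruples are coloured by the comparisons in the 2 by 2 subgrid they span. On a
  homogeneous set, small elements index rows and large ones columns. Reversing indices makes both
  directions increasing; one last flag decides which coordinate dominates.\<close>

lemma grid_canonical:
  "\<exists>N. \<forall>f :: nat \<Rightarrow> nat \<Rightarrow> nat. inj_on (\<lambda>(i, j). f i j) ({..<N} \<times> {..<N}) \<longrightarrow>
     (\<exists>u w. inj_on u {..<m} \<and> inj_on w {..<m} \<and> u ` {..<m} \<subseteq> {..<N} \<and> w ` {..<m} \<subseteq> {..<N}
       \<and> (row_lex m (\<lambda>p r. f (u p) (w r)) \<or> row_lex m (\<lambda>r p. f (u p) (w r))))"
proof -
  \<comment> \<open>There are \<open>m + 1\<close> rows and \<open>m + 1\<close> columns: a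
    comparison within one row or column still needs a second one to form a quadruple, and index
    \<open>m\<close> is the spare.\<close>
  define n where "n = 2 * m + 2"
  obtain N where N: "\<And>F :: nat set \<Rightarrow> bool \<times> bool \<times> bool \<times> bool.
      \<exists>H c. H \<in> nsets {..<N} n \<and> (\<forall>X\<in>nsets H 4. F X = c)"
    using finite_colour_Ramsey[where 'c = "bool \<times> bool \<times> bool \<times> bool"] by metis
  show ?thesis
  proof (rule exI[of _ N], intro allI impI)
    fix f :: "nat \<Rightarrow> nat \<Rightarrow> nat"
    assume inj: "inj_on (\<lambda>(i, j). f i j) ({..<N} \<times> {..<N})"
    \<comment> \<open>In order: within a row, within a column, indices moving oppositely, indices
      moving together.\<close>
    define col where "col p q r s = (f p r < f p s, f p r < f q r, f p s < f q r, f p r < f q s)"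
      for p q r s
    define F where "F X = (let l = sorted_list_of_set X in col (l ! 0) (l ! 1) (l ! 2) (l ! 3))"
      for X :: "nat set"
    obtain H a b c d where H: "H \<in> nsets {..<N} n" and hom: "\<And>X. X \<in> nsets H 4 \<Longrightarrow> F X = (a, b, c, d)"
      using N[of F] by (metis prod_cases4)
    define h where "h i = sorted_list_of_set H ! i" for i
    have fin: "finite H" and card: "card H = n" and HN: "H \<subseteq> {..<N}"
      using H by (auto simp: nsets_def)
    have hH: "h i \<in> H" if "i < n" for i
      using fin card that unfolding h_def by (metis length_sorted_list_of_set nth_mem set_sorted_list_of_set)
    have hless: "h i < h j" if "i < j" "j < n" for i j
      using fin card that unfolding h_def
      by (metis length_sorted_list_of_set sorted_wrt_nth_less strict_sorted_list_of_set)
    have flags: "col (h i) (h j) (h k) (h l) = (a, b, c, d)" if "i < j" "j < k" "k < l" "l < n" for i j k l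
    proof -
      have lt: "h i < h j" "h j < h k" "h k < h l" using hless that by auto
      have "sorted_list_of_set {h i, h j, h k, h l} = [h i, h j, h k, h l]"
        using lt by (intro sorted_list_of_set_unique[THEN iffD1]) auto
      moreover have "{h i, h j, h k, h l} \<in> nsets H 4"
        using lt hH that by (auto simp: nsets_def)
      ultimately show ?thesis
        using hom[of "{h i, h j, h k, h l}"] by (simp add: F_def)
    qed
    define g where "g p r = f (h p) (h (m + 1 + r))" for p r
    have ga: "g p r < g p s \<longleftrightarrow> a" and gb: "g p r < g q r \<longleftrightarrow> b" and gc: "g p s < g q r \<longleftrightarrow> c"
      and gd: "g p r < g q s \<longleftrightarrow> d" if "p < q" "q \<le> m" "r < s" "s \<le> m" for p q r s
      using flags[of p q "m + 1 + r" "m + 1 + s"] that by (auto simp: n_def g_def col_def)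
    have g_inj: "g p r \<noteq> g q s" if "p \<noteq> q \<or> r \<noteq> s" "p \<le> m" "q \<le> m" "r \<le> m" "s \<le> m" for p q r s
    proof
      assume eq: "g p r = g q s"
      have "h p < N" "h q < N" "h (m + 1 + r) < N" "h (m + 1 + s) < N"
        using hH HN that by (auto simp: n_def subset_iff)
      then have "h p = h q" "h (m + 1 + r) = h (m + 1 + s)"
        using eq inj unfolding g_def inj_on_def by auto
      then show False
        using hless[of p q] hless[of q p] hless[of "m + 1 + r" "m + 1 + s"]
          hless[of "m + 1 + s" "m + 1 + r"] that by (auto simp: n_def neq_iff)
    qed
    have not_less: "g p r < g q s \<longleftrightarrow> \<not> g q s < g p r"
      if "p \<noteq> q \<or> r \<noteq> s" "p \<le> m" "q \<le> m" "r \<le> m" "s \<le> m" for p q r s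
      using g_inj[OF that] by auto
    define \<sigma> where "\<sigma> p = (if b then p else m - 1 - p)" for p
    define \<tau> where "\<tau> r = (if a then r else m - 1 - r)" for r
    define u where "u p = h (\<sigma> p)" for p
    define w where "w r = h (m + 1 + \<tau> r)" for r
    have g_eq: "f (u p) (w r) = g (\<sigma> p) (\<tau> r)" for p r
      by (simp add: u_def w_def g_def)
    have \<sigma>_lt: "\<sigma> p < m" "\<tau> p < m" if "p < m" for p
      using that by (auto simp: \<sigma>_def \<tau>_def)
    have inc_col: "f (u p) (w r) < f (u p) (w s)" if "p < m" "r < s" "s < m" for p r s
    proof (cases a)
      case True
      then show ?thesis using ga[of "\<sigma> p" m r s] \<sigma>_lt[of p] that by (simp add: g_eq \<tau>_def)
    next
      case False
      have "m - 1 - s < m - 1 - r" using that by auto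
      with False show ?thesis
        using ga[of "\<sigma> p" m "m - 1 - s" "m - 1 - r"] \<sigma>_lt[of p] that
          g_inj[of "\<sigma> p" "\<sigma> p" "m - 1 - s" "m - 1 - r"]
        by (simp add: g_eq \<tau>_def)
    qed
    have inc_row: "f (u p) (w r) < f (u q) (w r)" if "p < q" "q < m" "r < m" for p q r
    proof (cases b)
      case True
      then show ?thesis using gb[of p q "\<tau> r" m] \<sigma>_lt[of r] that by (simp add: g_eq \<sigma>_def)
    next
      case False
      have "m - 1 - q < m - 1 - p" using that by auto
      with False show ?thesis
        using gb[of "m - 1 - q" "m - 1 - p" "\<tau> r" m] \<sigma>_lt[of r] that
          g_inj[of "m - 1 - q" "m - 1 - p" "\<tau> r" "\<tau> r"]
        by (simp add: g_eq \<sigma>_def)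
    qed
    \<comment> \<open>\<open>e\<close> says that the row index dominates after the reversals.
      Reversing one direction exchanges the roles of \<open>c\<close> and \<open>d\<close>;
      reversing the rows also swaps the two sides of the comparison, hence the negations.\<close>
    define e where "e = (if b then if a then c else d else if a then \<not> d else \<not> c)"
    have cross: "f (u p) (w s) < f (u q) (w r) \<longleftrightarrow> e" if "p < q" "q < m" "r < s" "s < m" for p q r s
    proof -
      have lt: "m - 1 - q < m - 1 - p" "m - 1 - p \<le> m" "m - 1 - s < m - 1 - r" "m - 1 - r \<le> m"
        using that by auto
      have le: "q \<le> m" "s \<le> m" "p < q" "r < s" using that by auto
      consider "a" "b" | "\<not> a" "b" | "a" "\<not> b" | "\<not> a" "\<not> b" by blast
      then show ?thesis
      proof cases
        case 1
        then show ?thesis using gc[OF le(3,1,4,2)] by (simp add: e_def g_eq \<sigma>_def \<tau>_def)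
      next
        case 2
        then show ?thesis using gd[OF le(3,1) lt(3,4)] by (simp add: e_def g_eq \<sigma>_def \<tau>_def)
      next
        case 3
        then have "f (u p) (w s) < f (u q) (w r) \<longleftrightarrow> \<not> g (m - 1 - q) r < g (m - 1 - p) s"
          using not_less[of "m - 1 - p" "m - 1 - q" s r] lt le by (simp add: g_eq \<sigma>_def \<tau>_def)
        then show ?thesis using 3 gd[OF lt(1,2) le(4,2)] by (simp add: e_def)
      next
        case 4
        then have "f (u p) (w s) < f (u q) (w r) \<longleftrightarrow> \<not> g (m - 1 - q) (m - 1 - r) < g (m - 1 - p) (m - 1 - s)"
          using not_less[of "m - 1 - p" "m - 1 - q" "m - 1 - s" "m - 1 - r"] lt by (simp add: g_eq \<sigma>_def \<tau>_def)
        then show ?thesis using 4 gc[OF lt] by (simp add: e_def)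
      qed
    qed
    have "row_lex m (\<lambda>p r. f (u p) (w r)) \<or> row_lex m (\<lambda>r p. f (u p) (w r))"
    proof (cases e)
      case True
      then have "row_lex m (\<lambda>p r. f (u p) (w r))"
        using inc_col inc_row cross by (intro row_lexI) auto
      then show ?thesis ..
    next
      \<comment> \<open>Now the column index dominates, so the transposed grid is
        lexicographic.\<close>
      case False
      have "f (u q) (w r) < f (u p) (w s)" if "p < q" "q < m" "r < s" "s < m" for p q r s
      proof -
        have "\<sigma> p \<noteq> \<sigma> q" using that by (auto simp: \<sigma>_def)
        then have "f (u q) (w r) \<noteq> f (u p) (w s)"
          using g_inj[of "\<sigma> q" "\<sigma> p"] \<sigma>_lt[of p] \<sigma>_lt[of q] \<sigma>_lt[of r] \<sigma>_lt[of s] that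
          by (simp add: g_eq)
        then show ?thesis using cross[OF that] False by auto
      qed
      then have "row_lex m (\<lambda>r p. f (u p) (w r))"
        using inc_col inc_row by (intro row_lexI) auto
      then show ?thesis ..
    qed
    moreover have "inj_on u {..<m}" "inj_on w {..<m}"
    proof -
      have hinj: "h i = h j \<Longrightarrow> i < n \<Longrightarrow> j < n \<Longrightarrow> i = j" for i j
        using hless[of i j] hless[of j i] by (cases i j rule: linorder_cases) auto
      have \<sigma>_inj: "\<sigma> p = \<sigma> q \<Longrightarrow> p = q" "\<tau> p = \<tau> q \<Longrightarrow> p = q" if "p < m" "q < m" for p q
        using that by (auto simp: \<sigma>_def \<tau>_def split: if_splits)
      have \<sigma>_n: "\<sigma> p < n" "m + 1 + \<tau> p < n" if "p < m" for p
        using \<sigma>_lt[OF that] by (auto simp: n_def)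
      show "inj_on u {..<m}"
      proof (rule inj_onI)
        fix p q assume *: "p \<in> {..<m}" "q \<in> {..<m}" "u p = u q"
        then have "\<sigma> p = \<sigma> q"
          using hinj[OF _ \<sigma>_n(1) \<sigma>_n(1)] unfolding u_def by simp
        then show "p = q" using * \<sigma>_inj by simp
      qed
      show "inj_on w {..<m}"
      proof (rule inj_onI)
        fix p q assume *: "p \<in> {..<m}" "q \<in> {..<m}" "w p = w q"
        then have "m + 1 + \<tau> p = m + 1 + \<tau> q"
          using hinj[OF _ \<sigma>_n(2) \<sigma>_n(2)] unfolding w_def by simp
        then show "p = q" using * \<sigma>_inj by simp
      qed
    qed
    moreover have "u ` {..<m} \<subseteq> {..<N}" "w ` {..<m} \<subseteq> {..<N}"
    proof -
      have "h i < N" if "i < n" for i using hH[OF that] HN by auto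
      moreover have "\<sigma> p < n" "m + 1 + \<tau> p < n" if "p < m" for p
        using \<sigma>_lt[OF that] by (auto simp: n_def)
      ultimately show "u ` {..<m} \<subseteq> {..<N}" "w ` {..<m} \<subseteq> {..<N}"
        unfolding u_def w_def by blast+
    qed
    ultimately show "\<exists>u w. inj_on u {..<m} \<and> inj_on w {..<m} \<and> u ` {..<m} \<subseteq> {..<N} \<and> w ` {..<m} \<subseteq> {..<N}
       \<and> (row_lex m (\<lambda>p r. f (u p) (w r)) \<or> row_lex m (\<lambda>r p. f (u p) (w r)))"
      by blast
  qed
qed

text \<open>The rank of an element counts the elements at most it. Ranks turn an arbitrary
  edge-ordering into a numerical function on the grid, as \<open>grid_canonical\<close>
  expects.\<close>

lemma linear_order_rank:
  assumes fin: "finite E" and lin: "linear_order_on E r"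
  shows "\<exists>rank :: 'a \<Rightarrow> nat. \<forall>e\<in>E. \<forall>e'\<in>E. (e, e') \<in> r \<longleftrightarrow> rank e \<le> rank e'"
proof (intro exI ballI)
  define D where "D e = {x \<in> E. (x, e) \<in> r}" for e
  fix e e' assume e: "e \<in> E" "e' \<in> E"
  have tr: "trans r" and total: "total_on E r" and refl: "refl_on E r" and anti: "antisym r"
    using lin by (auto simp: order_on_defs)
  have mono: "D a \<subseteq> D b" if "(a, b) \<in> r" for a b
    using that transD[OF tr] unfolding D_def by blast
  have finD: "finite (D a)" for a
    using fin by (simp add: D_def)
  show "(e, e') \<in> r \<longleftrightarrow> card (D e) \<le> card (D e')"
  proof
    assume "(e, e') \<in> r"
    then show "card (D e) \<le> card (D e')" by (intro card_mono finD mono)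
  next
    assume le: "card (D e) \<le> card (D e')"
    show "(e, e') \<in> r"
    proof (rule ccontr)
      assume n: "(e, e') \<notin> r"
      have re: "(e, e) \<in> r" using refl e by (auto simp: refl_on_def)
      then have "(e', e) \<in> r" using n e total by (metis total_on_def)
      then have "D e' \<subseteq> D e" by (rule mono)
      moreover have "e \<in> D e" "e \<notin> D e'" using n e re by (auto simp: D_def)
      ultimately have "D e' \<subset> D e" by blast
      then show False using le psubset_card_mono[OF finD] by (metis not_less)
    qed
  qed
qed

text \<open>The left vertices are \<open>0, 1, 2\<close>, and the right vertex \<open>r\<close> is called row \<open>r\<close>. The rows \<open>0\<close>
  and \<open>T + 1\<close> are the two inner ones, and between them there are \<open>T\<close> leaves, attached to the
  left vertices cyclically.\<close>

definition pattern_edge :: "nat \<Rightarrow> nat \<Rightarrow> nat \<Rightarrow> bool" where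
  "pattern_edge T c r \<longleftrightarrow> r = 0 \<and> c \<in> {0, 1} \<or> r = T + 1 \<and> c \<in> {0, 2}
     \<or> 1 \<le> r \<and> r \<le> T \<and> c = r mod 3"

abbreviation pattern_tree :: "nat \<Rightarrow> nat eograph" where
  "pattern_tree T \<equiv> bipartite_graph 3 (T + 5) (pattern_edge T)"

section \<open>The forbidden pattern is a tree\<close>

lemma cycle_two_neighbours:
  assumes "is_cycle G p" "v \<in> set p"
  obtains u w where "u \<in> set p" "w \<in> set p" "u \<noteq> w" "{v, u} \<in> edges G" "{v, w} \<in> edges G"
proof -
  define n where "n = length p"
  have n: "3 \<le> n" and dist: "distinct p"
    and edge: "\<And>i. i < n \<Longrightarrow> {p ! i, p ! (Suc i mod n)} \<in> edges G"
    using assms(1) by (auto simp: is_cycle_def n_def)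
  obtain i where i: "i < n" "v = p ! i"
    using assms(2) by (auto simp: in_set_conv_nth n_def)
  \<comment> \<open>The cyclic predecessor of \<open>i\<close>; it differs from the successor
    because \<open>n\<close> is at least 3.\<close>
  define j where "j = (if i = 0 then n - 1 else i - 1)"
  have j: "j < n" "Suc j mod n = i" "j \<noteq> Suc i mod n"
    using i n by (auto simp: j_def mod_Suc)
  have succ: "Suc i mod n < n" using n by simp
  show ?thesis
  proof
    show "p ! (Suc i mod n) \<in> set p" "p ! j \<in> set p"
      using j(1) succ unfolding n_def by (simp_all only: nth_mem)
    show "p ! (Suc i mod n) \<noteq> p ! j"
      using dist j succ by (simp add: nth_eq_iff_index_eq n_def)
    show "{v, p ! (Suc i mod n)} \<in> edges G" "{v, p ! j} \<in> edges G"
      using edge[OF i(1)] edge[OF j(1)] i j by (auto simp: insert_commute)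
  qed
qed

lemma is_tree_pattern_tree:
  assumes "T \<ge> 3"
  shows "is_tree (pattern_tree T)"
proof -
  let ?H = "pattern_tree T"
  let ?R = "{(x, y). {x, y} \<in> edges ?H}"
  have edge: "(c, 3 + r) \<in> ?R" "(3 + r, c) \<in> ?R" if "c < 3" "r \<le> T + 1" "pattern_edge T c r" for c r
    using that by (auto simp: edge_bipartite_graph_iff insert_commute[of "3 + r"])
  have to_0: "(v, 0) \<in> ?R\<^sup>*" if v: "v < T + 5" for v
  proof -
    have "(3, 0) \<in> ?R" "(4 + T, 0) \<in> ?R" "(1, 3) \<in> ?R" "(2, 4 + T) \<in> ?R"
      using edge[of 0 0] edge[of 0 "T + 1"] edge[of 1 0] edge[of 2 "T + 1"]
      by (auto simp: pattern_edge_def)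
    then have ends: "(3, 0) \<in> ?R\<^sup>*" "(4 + T, 0) \<in> ?R\<^sup>*" "(1, 0) \<in> ?R\<^sup>*" "(2, 0) \<in> ?R\<^sup>*"
      by (blast intro: rtrancl.rtrancl_refl converse_rtrancl_into_rtrancl)+
    show ?thesis
    proof (cases "v \<in> {0, 1, 2, 3, 4 + T}")
      case True
      then show ?thesis using ends by auto
    next
      case False
      then obtain r where r: "v = 3 + r" "1 \<le> r" "r \<le> T"
        using v by (intro that[of "v - 3"]) auto
      then have "(v, r mod 3) \<in> ?R"
        using edge[of "r mod 3" r] by (simp add: pattern_edge_def)
      moreover have "r mod 3 \<in> {0, 1, 2}" by auto
      then have "(r mod 3, 0) \<in> ?R\<^sup>*" using ends by auto
      ultimately show ?thesis by (rule converse_rtrancl_into_rtrancl)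
    qed
  qed
  have "sym (?R\<^sup>*)"
    by (intro sym_rtrancl symI) (auto simp: insert_commute)
  then have "connected_graph ?H"
    unfolding connected_graph_def using to_0
    by (auto simp: lessThan_empty_iff) (metis (no_types, lifting) rtrancl_trans symD)
  moreover have "\<not> is_cycle ?H p" for p
  proof
    assume cyc: "is_cycle ?H p"
    \<comment> \<open>A vertex with at most one neighbour on the cycle is not on it. This removes in
      turn the leaf rows, the left vertices 1 and 2, the two inner rows and finally the left vertex
      0.\<close>
    have one: "v \<notin> set p" if "\<And>u w. u \<in> set p \<Longrightarrow> w \<in> set p \<Longrightarrow> {v, u} \<in> edges ?H \<Longrightarrow> {v, w} \<in> edges ?H \<Longrightarrow> u = w" for v
      using that cycle_two_neighbours[OF cyc] by metis
    note nb = edge_bipartite_graphE[of _ _ 3 "T + 5" "pattern_edge T"]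
    have leaf: "3 + r \<notin> set p" if "1 \<le> r" "r \<le> T" for r
    proof (rule one)
      have "u = r mod 3" if "{3 + r, u} \<in> edges ?H" for u
        using that \<open>1 \<le> r\<close> \<open>r \<le> T\<close> by (auto elim!: nb simp: pattern_edge_def)
      then show "u = w" if "{3 + r, u} \<in> edges ?H" "{3 + r, w} \<in> edges ?H" for u w
        using that by blast
    qed
    have nbs: "u = 3 \<and> c \<in> {0, 1} \<or> u = T + 4 \<and> c \<in> {0, 2}"
      if "u \<in> set p" "{c, u} \<in> edges ?H" "c < 3" for c u
    proof -
      have "\<exists>r. u = 3 + r \<and> r \<le> T + 1 \<and> pattern_edge T c r"
        using that(2,3) by (auto elim!: nb)
      then show ?thesis
        using leaf that(1) unfolding pattern_edge_def by auto
    qed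
    have "u = 3" if "u \<in> set p" "{1, u} \<in> edges ?H" for u
      using nbs[OF that] by auto
    then have "1 \<notin> set p" by (intro one) metis
    moreover have "u = T + 4" if "u \<in> set p" "{2, u} \<in> edges ?H" for u
      using nbs[OF that] by auto
    then have "2 \<notin> set p" by (intro one) metis
    moreover have "u = 0" if "u \<in> {0, 1, 2}" "u \<in> set p" for u
      using calculation that by auto
    moreover have "u \<in> {0, 1, 2}" if "{v, u} \<in> edges ?H" "v \<ge> 3" for u v
      using that by (auto elim!: nb)
    ultimately have "v \<notin> set p" if "v \<ge> 3" for v
      using that by (intro one) metis
    then have "v \<notin> set p" for v
      using nbs[of _ v] by (cases "v < 3") (intro one, fastforce, simp)
    then have "p = []" by (cases p) auto
    then show False using cyc by (simp add: is_cycle_def)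
  qed
  ultimately show ?thesis
    using edge_ordered_bipartite_graph[of 3 "T + 5" "pattern_edge T"]
    by (simp add: is_tree_def edge_ordered_graph_def)
qed

text \<open>All edges between the images of \<open>\<rho>\<close> and \<open>\<kappa>\<close> are
  present, so any \<open>P\<close> embeds: \<open>\<rho>\<close> places the right vertices, whose
  index leads the order, and \<open>\<kappa>\<close> the three left ones.\<close>

lemma contains_bipartite_graph_of_rank:
  assumes K: "edge_ordered_graph K" and nm: "n \<le> 3 + m" "3 \<le> m"
    and rank: "\<And>e e'. e \<in> edges K \<Longrightarrow> e' \<in> edges K \<Longrightarrow> (e, e') \<in> eorder K \<longleftrightarrow> rank e \<le> rank e'"
    and lex: "row_lex m (\<lambda>r c. rank {\<rho> r, \<kappa> c})"
    and inj: "inj_on \<rho> {..<m}" "inj_on \<kappa> {..<m}" "\<rho> ` {..<m} \<inter> \<kappa> ` {..<m} = {}"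
    and K_verts: "\<rho> ` {..<m} \<subseteq> verts K" "\<kappa> ` {..<m} \<subseteq> verts K"
    and K_edges: "\<And>r c. r < m \<Longrightarrow> c < m \<Longrightarrow> {\<rho> r, \<kappa> c} \<in> edges K"
  shows "eo_contains K (bipartite_graph 3 n P)"
proof -
  let ?H = "bipartite_graph 3 n P"
  define f where "f v = (if v < 3 then \<kappa> v else \<rho> (v - 3))" for v :: nat
  have f_edge: "f ` {c, 3 + r} = {\<rho> r, \<kappa> c}" if "c < 3" for c r
    using that by (auto simp: f_def)
  have f_cases: "v < 3 \<and> v < m \<and> f v = \<kappa> v \<or> 3 \<le> v \<and> v - 3 < m \<and> f v = \<rho> (v - 3)" if "v < n" for v
    using that nm by (auto simp: f_def)
  have lt: "rank {\<rho> r, \<kappa> c} < rank {\<rho> r', \<kappa> c'}"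
    if "r < r' \<or> r = r' \<and> c < c'" "r < m" "r' < m" "c < m" "c' < m" for r r' c c'
    using lex that unfolding row_lex_def by blast
  have rank_iff: "rank {\<rho> r, \<kappa> c} \<le> rank {\<rho> r', \<kappa> c'} \<longleftrightarrow> r < r' \<or> r = r' \<and> c \<le> c'"
    if "r < m" "r' < m" "c < m" "c' < m" for r r' c c'
    using lt[of r r' c c'] lt[of r' r c' c] that
    by (cases "r = r'"; cases "c = c'"; cases "r < r'"; cases "c < c'") auto
  have edgeD: "\<exists>c r. e = {c, 3 + r} \<and> c < 3 \<and> c < m \<and> r < m \<and> 3 + r < n \<and> P c r" if e: "e \<in> edges ?H" for e
  proof -
    obtain x y where "e = {x, 3 + y}" "x < 3" "3 + y < n" "P x y"
      using e unfolding edges_bipartite_graph by blast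
    then show ?thesis using nm by (intro exI[of _ x] exI[of _ y]) auto
  qed
  have "inj_on f (verts ?H)"
  proof (rule inj_onI)
    fix v w assume "v \<in> verts ?H" "w \<in> verts ?H" and eq: "f v = f w"
    then have "v < n" "w < n" by auto
    have inj_\<rho>: "\<rho> r = \<rho> r' \<Longrightarrow> r = r'" and inj_\<kappa>: "\<kappa> r = \<kappa> r' \<Longrightarrow> r = r'" and disj: "\<rho> r \<noteq> \<kappa> r'"
      if "r < m" "r' < m" for r r'
      using inj that unfolding inj_on_def by auto
    show "v = w"
      using f_cases[OF \<open>v < n\<close>] f_cases[OF \<open>w < n\<close>]
    proof (elim disjE conjE)
      assume "v < m" "w < m" "f v = \<kappa> v" "f w = \<kappa> w"
      then show ?thesis using eq inj_\<kappa> by simp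
    next
      assume "3 \<le> v" "3 \<le> w" "v - 3 < m" "w - 3 < m" "f v = \<rho> (v - 3)" "f w = \<rho> (w - 3)"
      then show ?thesis using eq inj_\<rho>[of "v - 3" "w - 3"] by simp
    qed (use eq disj in metis)+
  qed
  moreover have "f ` verts ?H \<subseteq> verts K"
  proof
    fix x assume "x \<in> f ` verts ?H"
    then obtain v where v: "v < n" "x = f v" by auto
    from f_cases[OF v(1)] show "x \<in> verts K" using K_verts v(2) by auto
  qed
  moreover have "f ` e \<in> edges K" if "e \<in> edges ?H" for e
    using edgeD[OF that] K_edges f_edge by auto
  moreover have "(e, e') \<in> eorder ?H \<longleftrightarrow> (f ` e, f ` e') \<in> eorder K"
    if e: "e \<in> edges ?H" "e' \<in> edges ?H" for e e'
  proof -
    obtain c r where cr: "e = {c, 3 + r}" "c < 3" "c < m" "r < m" "3 + r < n" "P c r"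
      using edgeD[OF e(1)] by blast
    obtain c' r' where cr': "e' = {c', 3 + r'}" "c' < 3" "c' < m" "r' < m" "3 + r' < n" "P c' r'"
      using edgeD[OF e(2)] by blast
    have "(f ` e, f ` e') \<in> eorder K \<longleftrightarrow> r < r' \<or> r = r' \<and> c \<le> c'"
      unfolding cr(1) cr'(1) f_edge[OF cr(2)] f_edge[OF cr'(2)]
      using cr cr' K_edges by (simp add: rank rank_iff)
    moreover have "(e, e') \<in> eorder ?H \<longleftrightarrow> r < r' \<or> r = r' \<and> c \<le> c'"
      unfolding cr(1) cr'(1) using cr cr' by (simp add: eorder_bipartite_graph_iff)
    ultimately show ?thesis by simp
  qed
  ultimately show ?thesis
    unfolding eo_contains_iff[OF K edge_ordered_bipartite_graph] by blast
qed

text \<open>The host is a balanced complete bipartite graph. The two outcomes of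
  \<open>grid_canonical\<close> give the embedding directly or with the sides exchanged.\<close>

lemma ex_unavoidable_host:
  "\<exists>G :: nat graph. simple_graph G \<and> colorable G 2 \<and>
     (\<forall>ord. linear_order_on (edges G) ord \<longrightarrow>
        eo_contains \<lparr>verts = verts G, edges = edges G, eorder = ord\<rparr> (bipartite_graph 3 n P))"
proof -
  define m where "m = n + 3"
  obtain N where N: "\<And>f :: nat \<Rightarrow> nat \<Rightarrow> nat. inj_on (\<lambda>(i, j). f i j) ({..<N} \<times> {..<N}) \<Longrightarrow>
     (\<exists>u w. inj_on u {..<m} \<and> inj_on w {..<m} \<and> u ` {..<m} \<subseteq> {..<N} \<and> w ` {..<m} \<subseteq> {..<N}
       \<and> (row_lex m (\<lambda>p r. f (u p) (w r)) \<or> row_lex m (\<lambda>r p. f (u p) (w r))))"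
    using grid_canonical by metis
  define E where "E = {{i, N + j} |i j. i < N \<and> j < N}"
  define G :: "nat graph" where "G = \<lparr>verts = {..<2 * N}, edges = E\<rparr>"
  have card_E: "e \<subseteq> {..<2 * N} \<and> card e = 2" if "e \<in> E" for e
    using that by (auto simp: E_def)
  then have simple: "simple_graph G"
    by (auto simp: simple_graph_def G_def)
  have "E \<subseteq> Pow {..<2 * N}" using card_E by auto
  then have "finite E" by (rule finite_subset) simp
  have "colorable G 2"
    unfolding colorable_def
    by (rule exI[of _ "\<lambda>v. if v < N then 0 else 1"]) (auto simp: G_def E_def doubleton_eq_iff)
  moreover have "eo_contains \<lparr>verts = verts G, edges = edges G, eorder = ord\<rparr> (bipartite_graph 3 n P)"
    if lin: "linear_order_on (edges G) ord" for ord
  proof -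
    let ?K = "\<lparr>verts = verts G, edges = edges G, eorder = ord\<rparr>"
    have K: "edge_ordered_graph ?K"
      using simple lin by (auto simp: edge_ordered_graph_def simple_graph_def)
    have lin_E: "linear_order_on E ord" using lin by (simp add: G_def)
    obtain rank :: "nat set \<Rightarrow> nat"
      where rank: "\<And>e e'. e \<in> E \<Longrightarrow> e' \<in> E \<Longrightarrow> (e, e') \<in> ord \<longleftrightarrow> rank e \<le> rank e'"
      using linear_order_rank[OF \<open>finite E\<close> lin_E] by blast
    have rank_inj: "e = e'" if "e \<in> E" "e' \<in> E" "rank e = rank e'" for e e'
    proof -
      have "(e, e') \<in> ord" "(e', e) \<in> ord" using that by (auto simp: rank)
      then show ?thesis using lin_E by (auto simp: order_on_defs antisym_def)
    qed
    have "inj_on (\<lambda>(i, j). rank {i, N + j}) ({..<N} \<times> {..<N})"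
    proof (rule inj_onI, clarify)
      fix i j i' j' assume *: "i < N" "j < N" "i' < N" "j' < N" "rank {i, N + j} = rank {i', N + j'}"
      then have "{i, N + j} = {i', N + j'}" by (intro rank_inj) (auto simp: E_def)
      then show "i = i' \<and> j = j'" using * by (auto simp: doubleton_eq_iff)
    qed
    then obtain u w where uw: "inj_on u {..<m}" "inj_on w {..<m}" "u ` {..<m} \<subseteq> {..<N}" "w ` {..<m} \<subseteq> {..<N}"
      and lex: "row_lex m (\<lambda>p r. rank {u p, N + w r}) \<or> row_lex m (\<lambda>r p. rank {u p, N + w r})"
      using N[of "\<lambda>i j. rank {i, N + j}"] by blast
    have u: "u p < N" and w: "w p < N" if "p < m" for p using uw that by auto
    have edge: "{u p, N + w r} \<in> edges ?K" "{N + w r, u p} \<in> edges ?K" if "p < m" "r < m" for p r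
      using u w that by (auto simp: G_def E_def)
    have inj_w: "inj_on (\<lambda>r. N + w r) {..<m}" using uw(2) by (simp add: inj_on_def)
    have disj: "u ` {..<m} \<inter> (\<lambda>r. N + w r) ` {..<m} = {}" "(\<lambda>r. N + w r) ` {..<m} \<inter> u ` {..<m} = {}"
      using u by fastforce+
    have in_verts: "u ` {..<m} \<subseteq> verts ?K" "(\<lambda>r. N + w r) ` {..<m} \<subseteq> verts ?K"
      using u w by (fastforce simp: G_def)+
    have rank_K: "(e, e') \<in> eorder ?K \<longleftrightarrow> rank e \<le> rank e'" if "e \<in> edges ?K" "e' \<in> edges ?K" for e e'
      using rank that by (simp add: G_def)
    from lex show ?thesis
    proof
      assume lex: "row_lex m (\<lambda>p r. rank {u p, N + w r})"
      show ?thesis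
        by (rule contains_bipartite_graph_of_rank[of _ n m rank u "\<lambda>r. N + w r"])
          (use K rank_K lex uw(1) inj_w disj in_verts edge in \<open>auto simp: m_def\<close>)
    next
      assume "row_lex m (\<lambda>r p. rank {u p, N + w r})"
      then have lex: "row_lex m (\<lambda>r p. rank {N + w r, u p})" by (simp add: insert_commute)
      show ?thesis
        by (rule contains_bipartite_graph_of_rank[of _ n m rank "\<lambda>r. N + w r" u])
          (use K rank_K lex uw(1) inj_w disj in_verts edge in \<open>auto simp: m_def\<close>)
    qed
  qed
  ultimately show ?thesis using simple by blast
qed

section \<open>Chromatic numbers\<close>

lemma chromatic_number_ge_2:
  assumes G: "simple_graph G" and "edges G \<noteq> {}"
  shows "chromatic_number G \<ge> 2"
proof -
  obtain e where e: "e \<in> edges G" using assms(2) by blast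
  then have "card e = 2" "e \<subseteq> verts G" using G by (auto simp: simple_graph_def)
  then obtain u v where uv: "e = {u, v}" "u \<noteq> v" "u \<in> verts G" "v \<in> verts G"
    by (auto simp: card_2_iff)
  have "finite (verts G)" using G by (simp add: simple_graph_def)
  then obtain h where "bij_betw h (verts G) {..<card (verts G)}"
    using ex_bij_betw_finite_nat[of "verts G"] by (auto simp: atLeast0LessThan)
  moreover have "a \<noteq> b" if "{a, b} \<in> edges G" for a b
    using G that by (auto simp: simple_graph_def)
  \<comment> \<open>\<open>LEAST\<close> is attained only if some colouring exists; an injective
    numbering of the vertices is one.\<close>
  ultimately have "colorable G (card (verts G))"
    unfolding colorable_def by (intro exI[of _ h]) (auto simp: bij_betw_def inj_on_def)
  then have "colorable G (chromatic_number G)"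
    unfolding chromatic_number_def by (rule LeastI)
  then obtain c where "c ` verts G \<subseteq> {..<chromatic_number G}" "c u \<noteq> c v"
    using uv e unfolding colorable_def by blast
  then have "c u < chromatic_number G" "c v < chromatic_number G" "c u \<noteq> c v"
    using uv by auto
  then show ?thesis by linarith
qed

lemma order_chromatic_number_bipartite_graph:
  assumes "edges (bipartite_graph 3 n P) \<noteq> {}"
  shows "order_chromatic_number (bipartite_graph 3 n P) = 2"
proof -
  let ?H = "bipartite_graph 3 n P"
  let ?host = "\<lambda>G :: nat graph. simple_graph G \<and> (\<forall>ord. linear_order_on (edges G) ord \<longrightarrow>
        eo_contains \<lparr>verts = verts G, edges = edges G, eorder = ord\<rparr> ?H)"
  have lower: "chromatic_number G \<ge> 2" if "?host G" for G
  proof (rule chromatic_number_ge_2)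
    show "simple_graph G" using that by blast
    show "edges G \<noteq> {}"
    proof
      assume "edges G = {}"
      then have "linear_order_on (edges G) {}" by (simp add: order_on_defs)
      then have "eo_contains \<lparr>verts = verts G, edges = edges G, eorder = {}\<rparr> ?H"
        using that by blast
      then obtain K where K: "edges K \<subseteq> edges G" "eo_isomorphic ?H K"
        by (auto simp: eo_contains_def eo_subgraph_def)
      then have "edges ?H = {}"
        using \<open>edges G = {}\<close> by (auto simp: eo_isomorphic_def)
      then show False using assms by contradiction
    qed
  qed
  obtain G :: "nat graph" where G: "?host G" "colorable G 2"
    using ex_unavoidable_host by blast
  then have "chromatic_number G = 2"
    using lower[of G] unfolding chromatic_number_def by (meson Least_le le_antisym)
  then have "enat 2 \<in> {enat (chromatic_number G) |G. ?host G}"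
    using G by force
  moreover have "enat 2 \<le> x" if "x \<in> {enat (chromatic_number G) |G. ?host G}" for x
    using that lower by auto
  ultimately have "Inf {enat (chromatic_number G) |G. ?host G} = enat 2"
    by (intro antisym Inf_lower Inf_greatest)
  then show ?thesis
    unfolding order_chromatic_number_def by (simp add: numeral_eq_enat)
qed

subsection \<open>The dense graph\<close>

text \<open>Position 0 is least significant. Hence comparing numbers below \<open>B ^ b\<close>
  compares tuples lexicographically, with coordinate \<open>b - 1\<close> leading.\<close>

definition digit :: "nat \<Rightarrow> nat \<Rightarrow> nat \<Rightarrow> nat" where
  "digit B i y = y div B ^ i mod B"

lemma div_power_Suc_digit: "y div B ^ i = B * (y div B ^ Suc i) + digit B i y"
  unfolding digit_def by (metis div_mult2_eq mult.commute mult_div_mod_eq power_Suc)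

lemma eq_if_digits_eq:
  assumes "x div B ^ b = x' div B ^ b" "\<And>i. i < b \<Longrightarrow> digit B i x = digit B i x'"
  shows "x = x'"
proof -
  have "x div B ^ i = x' div B ^ i" if "i \<le> b" for i
    using that
  proof (induction rule: inc_induct)
    case (step i)
    then show ?case using assms(2)[of i] by (simp add: div_power_Suc_digit[of _ B i] del: power_Suc)
  qed (use assms(1) in simp)
  from this[of 0] show ?thesis by simp
qed

text \<open>Splitting off the top digit by division with remainder by \<open>B ^ b\<close> is a
  bijection onto a product, which gives the induction step.\<close>

lemma card_digits:
  assumes "B > 0" "\<And>i. i < b \<Longrightarrow> S i \<subseteq> {..<B}"
  shows "card {y. y < B ^ b \<and> (\<forall>i<b. digit B i y \<in> S i)} = (\<Prod>i<b. card (S i))"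
  using assms(2)
proof (induction b)
  case 0
  have "{y. y < (1 :: nat)} = {0}" by auto
  then show ?case by simp
next
  case (Suc b)
  let ?Y = "\<lambda>b. {y. y < B ^ b \<and> (\<forall>i<b. digit B i y \<in> S i)}"
  have digit_add: "digit B i (y + B ^ b * s) = (if i = b then s else digit B i y)"
    if "y < B ^ b" "s < B" "i \<le> b" for i y s
  proof (cases "i = b")
    case True
    then show ?thesis using that by (simp add: digit_def)
  next
    case False
    then have "B ^ b = B ^ i * (B * B ^ (b - Suc i))"
      using that(3) by (metis Suc_diff_Suc le_neq_implies_less power_Suc power_add ordered_cancel_comm_monoid_diff_class.add_diff_inverse)
    then have "(y + B ^ b * s) div B ^ i = B * (B ^ (b - Suc i) * s) + y div B ^ i"
      using \<open>B > 0\<close> by (simp add: mult.assoc)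
    then show ?thesis using False by (simp add: digit_def)
  qed
  have bound: "y + B ^ b * s < B ^ Suc b" if "y < B ^ b" "s < B" for y s
  proof -
    have "y + B ^ b * s < B ^ b * Suc s" using that by simp
    also have "\<dots> \<le> B ^ b * B" using that(2) by (intro mult_le_mono) auto
    finally show ?thesis by (simp add: mult.commute)
  qed
  have "bij_betw (\<lambda>(y, s). y + B ^ b * s) (?Y b \<times> S b) (?Y (Suc b))"
  proof (rule bij_betw_byWitness[where f' = "\<lambda>y. (y mod B ^ b, y div B ^ b)"])
    show "\<forall>a\<in>?Y b \<times> S b. (case case a of (y, s) \<Rightarrow> y + B ^ b * s of y \<Rightarrow> (y mod B ^ b, y div B ^ b)) = a"
      using \<open>B > 0\<close> by auto
    show "\<forall>y\<in>?Y (Suc b). (case (y mod B ^ b, y div B ^ b) of (y, s) \<Rightarrow> y + B ^ b * s) = y"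
      by simp
    show "(\<lambda>(y, s). y + B ^ b * s) ` (?Y b \<times> S b) \<subseteq> ?Y (Suc b)"
    proof clarify
      fix y s assume y: "y < B ^ b" "\<forall>i<b. digit B i y \<in> S i" and s: "s \<in> S b"
      then have "s < B" using Suc.prems[of b] by auto
      then show "y + B ^ b * s < B ^ Suc b \<and> (\<forall>i<Suc b. digit B i (y + B ^ b * s) \<in> S i)"
        using y s bound[OF y(1)] by (simp add: digit_add less_Suc_eq_le del: power_Suc)
    qed
    show "(\<lambda>y. (y mod B ^ b, y div B ^ b)) ` ?Y (Suc b) \<subseteq> ?Y b \<times> S b"
    proof (rule image_subsetI)
      fix y assume "y \<in> ?Y (Suc b)"
      then have y: "y < B ^ Suc b" "\<forall>i<Suc b. digit B i y \<in> S i" by auto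
      have lt: "y mod B ^ b < B ^ b" "y div B ^ b < B"
        using \<open>B > 0\<close> y(1) by (auto simp: less_mult_imp_div_less)
      have "digit B i y = (if i = b then y div B ^ b else digit B i (y mod B ^ b))" if "i \<le> b" for i
        using digit_add[OF lt that] by simp
      then have "digit B b y = y div B ^ b" "\<And>i. i < b \<Longrightarrow> digit B i y = digit B i (y mod B ^ b)"
        by simp_all
      then have "y div B ^ b \<in> S b" "\<forall>i<b. digit B i (y mod B ^ b) \<in> S i"
        using y(2) by (force, metis less_SucI)
      then show "(y mod B ^ b, y div B ^ b) \<in> ?Y b \<times> S b"
        using lt by simp
    qed
  qed
  from bij_betw_same_card[OF this] have "card (?Y (Suc b)) = card (?Y b) * card (S b)"
    by (simp only: card_cartesian_product)
  also have "card (?Y b) = (\<Prod>i<b. card (S i))"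
    using Suc.prems by (intro Suc.IH) auto
  finally show ?case by (simp only: prod.lessThan_Suc)
qed

text \<open>A left vertex \<open>x < q ^ (b + 1)\<close> consists of the slope \<open>x div q ^ b\<close> and \<open>b\<close> intercepts, its
  \<open>q\<close>-ary digits. A right vertex \<open>y\<close> is a tuple of \<open>b\<close> points of the plane, where the digit
  \<open>K * z + t\<close> stands for the point \<open>(t, z)\<close>. Adjacency means that for each \<open>i < b\<close> the \<open>i\<close>-th point
  of \<open>y\<close> lies on the line given by the slope and the \<open>i\<close>-th intercept of \<open>x\<close>.\<close>

definition host_edge :: "nat \<Rightarrow> nat \<Rightarrow> nat \<Rightarrow> nat \<Rightarrow> nat \<Rightarrow> bool" where
  "host_edge K q b x y \<longleftrightarrow> y < (K * (K * q)) ^ b \<and>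
     (\<forall>i<b. let d = digit (K * (K * q)) i y
        in d div K = (x div q ^ b) * (d mod K) + digit q i x)"

text \<open>A line meets each of the \<open>K\<close> grid columns in one point, and
  \<open>mod K\<close> is the column. So in each coordinate the neighbours of \<open>x\<close> take
  at most \<open>K\<close> values, ready for the pigeonhole principle.\<close>

lemma host_edge_digit_eq:
  assumes "host_edge K q b x y" "host_edge K q b x y'" "i < b"
    and "digit (K * (K * q)) i y mod K = digit (K * (K * q)) i y' mod K"
  shows "digit (K * (K * q)) i y = digit (K * (K * q)) i y'"
proof -
  have "digit (K * (K * q)) i y div K = digit (K * (K * q)) i y' div K"
    using assms by (auto simp: host_edge_def Let_def)
  with assms(4) show ?thesis by (metis mult_div_mod_eq)
qed

text \<open>Two lines through a common point that share a second point have the same slope; with the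
  slope, \<open>y\<close> determines all intercepts.\<close>

lemma host_edge_unique:
  assumes xy: "host_edge K q b x y" "host_edge K q b x y1"
    and xy': "host_edge K q b x' y" "host_edge K q b x' y2"
    and i: "i < b" "digit (K * (K * q)) i y1 = digit (K * (K * q)) i y2"
      "digit (K * (K * q)) i y1 \<noteq> digit (K * (K * q)) i y"
  shows "x = x'"
proof -
  let ?B = "K * (K * q)"
  \<comment> \<open>Working in the integers allows the four incidence equations to be subtracted,
    leaving slope difference times column difference equal to zero.\<close>
  define \<mu> \<mu>' where "\<mu> = int (x div q ^ b)" and "\<mu>' = int (x' div q ^ b)"
  define t t1 where "t = int (digit ?B i y mod K)" and "t1 = int (digit ?B i y1 mod K)"
  have "t \<noteq> t1"
    using host_edge_digit_eq[OF xy i(1)] i(3) by (auto simp: t_def t1_def)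
  have "int (digit ?B i y div K) = \<mu> * t + int (digit q i x)"
       "int (digit ?B i y1 div K) = \<mu> * t1 + int (digit q i x)"
       "int (digit ?B i y div K) = \<mu>' * t + int (digit q i x')"
       "int (digit ?B i y1 div K) = \<mu>' * t1 + int (digit q i x')"
    using xy xy' i(1,2) unfolding host_edge_def Let_def \<mu>_def \<mu>'_def t_def t1_def
    by (metis of_nat_add of_nat_mult)+
  then have "(\<mu> - \<mu>') * (t - t1) = 0" by (simp add: algebra_simps)
  then have "\<mu> = \<mu>'" using \<open>t \<noteq> t1\<close> by simp
  then have slope: "x div q ^ b = x' div q ^ b" by (simp add: \<mu>_def \<mu>'_def)
  show ?thesis
  proof (rule eq_if_digits_eq[OF slope])
    fix j assume "j < b"
    then show "digit q j x = digit q j x'"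
      using xy(1) xy'(1) slope unfolding host_edge_def Let_def by (metis add_left_cancel)
  qed
qed

text \<open>A neighbour amounts to choosing a column for each of the \<open>b\<close> points. Slope
  and intercept are at most \<open>q - 1\<close> and columns at most \<open>K - 1\<close>, so
  heights stay below \<open>K * q\<close> and every choice fits into a digit.\<close>

lemma card_host_edges:
  assumes "x < q ^ (b + 1)" "K > 0" "q > 0"
  shows "card {y. host_edge K q b x y} = K ^ b"
proof -
  let ?B = "K * (K * q)"
  define p where "p i t = K * ((x div q ^ b) * t + digit q i x) + t" for i t
  have slope: "x div q ^ b < q" using assms by (simp add: less_mult_imp_div_less)
  have "p i t < ?B" if "t < K" for i t
  proof -
    have "digit q i x < q" using assms(3) by (simp add: digit_def)
    moreover have "(x div q ^ b) * t \<le> (q - 1) * (K - 1)" using slope that by (intro mult_le_mono) auto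
    ultimately have "(x div q ^ b) * t + digit q i x < (q - 1) * (K - 1) + q" by linarith
    also have "\<dots> \<le> (q - 1) * (K - 1) + (q - 1) + K"
      using \<open>K > 0\<close> by linarith
    also have "(q - 1) * (K - 1) + (q - 1) = (q - 1) * K"
      using \<open>K > 0\<close> by (cases K) auto
    also have "(q - 1) * K + K = K * q" using \<open>q > 0\<close> by (cases q) auto
    finally have "K * Suc ((x div q ^ b) * t + digit q i x) \<le> ?B" by (intro mult_le_mono) auto
    then show ?thesis using that by (simp add: p_def)
  qed
  then have S: "p i ` {..<K} \<subseteq> {..<?B}" for i by auto
  have mem: "d \<in> p i ` {..<K} \<longleftrightarrow> d div K = (x div q ^ b) * (d mod K) + digit q i x" for d i
  proof
    assume "d div K = (x div q ^ b) * (d mod K) + digit q i x"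
    then have "d = p i (d mod K)" unfolding p_def by (metis mult_div_mod_eq)
    then show "d \<in> p i ` {..<K}" using \<open>K > 0\<close> by auto
  qed (auto simp: p_def)
  have "inj_on (p i) {..<K}" for i
    by (rule inj_on_inverseI[where g = "\<lambda>d. d mod K"]) (simp add: p_def)
  then have "card (p i ` {..<K}) = K" for i by (simp add: card_image)
  moreover have "{y. host_edge K q b x y} = {y. y < ?B ^ b \<and> (\<forall>i<b. digit ?B i y \<in> p i ` {..<K})}"
    unfolding host_edge_def mem by (simp add: Let_def)
  ultimately show ?thesis
    using card_digits[of ?B b "\<lambda>i. p i ` {..<K}"] S assms by simp
qed

lemma card_edges_host:
  assumes "K > 0" "q > 0" "q ^ (b + 1) + (K * (K * q)) ^ b \<le> n"
  shows "card (edges (bipartite_graph (q ^ (b + 1)) n (host_edge K q b))) = q ^ (b + 1) * K ^ b"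
proof -
  let ?N = "q ^ (b + 1)"
  let ?S = "SIGMA x:{..<?N}. {y. host_edge K q b x y}"
  have lt: "?N + y < n" if "host_edge K q b x y" for x y
    using that assms(3) by (auto simp: host_edge_def)
  have fin: "finite {y. host_edge K q b x y}" for x
    by (rule finite_subset[of _ "{..<(K * (K * q)) ^ b}"]) (auto simp: host_edge_def)
  have "edges (bipartite_graph ?N n (host_edge K q b)) = (\<lambda>(x, y). {x, ?N + y}) ` ?S"
    unfolding edges_bipartite_graph using lt by (auto simp: image_def)
  moreover have "inj_on (\<lambda>(x, y). {x, ?N + y}) ?S"
    by (rule inj_onI) (auto simp: doubleton_eq_iff)
  ultimately have "card (edges (bipartite_graph ?N n (host_edge K q b))) = card ?S"
    by (simp add: card_image)
  also have "\<dots> = (\<Sum>x<?N. card {y. host_edge K q b x y})"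
    using fin by (simp add: card_SigmaI)
  also have "\<dots> = ?N * K ^ b"
    using card_host_edges[OF _ assms(1,2), of _ b] by simp
  finally show ?thesis .
qed

section \<open>The dense graph avoids the tree\<close>

lemma host_avoids_pattern:
  fixes K q b n :: nat
  assumes "K > 0"
  defines "N \<equiv> q ^ (b + 1)" and "T \<equiv> 3 * (K + 1)"
  shows "\<not> eo_contains (bipartite_graph N n (host_edge K q b)) (pattern_tree T)"
proof
  let ?G = "bipartite_graph N n (host_edge K q b)" and ?H = "pattern_tree T"
  assume "eo_contains ?G ?H"
  then obtain f where inj: "inj_on f {..<T + 5}"
    and edge: "\<And>e. e \<in> edges ?H \<Longrightarrow> f ` e \<in> edges ?G"
    and ord: "\<And>e e'. e \<in> edges ?H \<Longrightarrow> e' \<in> edges ?H \<Longrightarrow> (e, e') \<in> eorder ?H \<Longrightarrow> (f ` e, f ` e') \<in> eorder ?G"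
    unfolding eo_contains_iff[OF edge_ordered_bipartite_graph edge_ordered_bipartite_graph]
    by auto
  define \<kappa> where "\<kappa> c = f c" for c
  define \<rho> where "\<rho> r = f (3 + r)" for r
  have edge': "{\<kappa> c, \<rho> r} \<in> edges ?G" if "pattern_edge T c r" "c < 3" "r \<le> T + 1" for c r
    using edge[of "{c, 3 + r}"] that by (simp add: edge_bipartite_graph_iff \<kappa>_def \<rho>_def)
  have ord': "({\<kappa> c, \<rho> r}, {\<kappa> c', \<rho> r'}) \<in> eorder ?G"
    if "pattern_edge T c r" "c < 3" "r \<le> T + 1" "pattern_edge T c' r'" "c' < 3" "r' \<le> T + 1"
      "r < r' \<or> r = r' \<and> c \<le> c'" for c r c' r'
    using ord[of "{c, 3 + r}" "{c', 3 + r'}"] that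
    by (simp add: edge_bipartite_graph_iff eorder_bipartite_graph_iff \<kappa>_def \<rho>_def)
  have f_neq: "f v \<noteq> f w" if "v < T + 5" "w < T + 5" "v \<noteq> w" for v w
    using inj that by (auto simp: inj_on_def)
  have pe: "pattern_edge T 0 0" "pattern_edge T 1 0" "pattern_edge T 0 (T + 1)"
    "pattern_edge T 2 (T + 1)" "pattern_edge T 0 3"
    "\<And>r. 1 \<le> r \<Longrightarrow> r \<le> T \<Longrightarrow> pattern_edge T (r mod 3) r"
    by (auto simp: pattern_edge_def T_def)
  have sides: "\<kappa> c < N \<and> \<rho> r \<ge> N \<or> \<rho> r < N \<and> \<kappa> c \<ge> N" if "pattern_edge T c r" "c < 3" "r \<le> T + 1" for c r
    using edge'[OF that] by (auto elim!: edge_bipartite_graphE)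
  \<comment> \<open>In the other orientation the right endpoints \<open>\<kappa> 0\<close>,
    \<open>\<kappa> 1\<close>, \<open>\<kappa> 0\<close> of three increasing edges would be weakly
    increasing, forcing \<open>\<kappa> 0 = \<kappa> 1\<close>.\<close>
  have \<kappa>_0: "\<kappa> 0 < N"
  proof (rule ccontr)
    assume "\<not> \<kappa> 0 < N"
    then have "N \<le> \<kappa> 0" "\<rho> 0 < N" "N \<le> \<kappa> 1" "\<rho> 3 < N"
      using sides[OF pe(1)] sides[OF pe(2)] sides[OF pe(5)] by (auto simp: T_def)
    then obtain y y' where y: "\<kappa> 0 = N + y" "\<kappa> 1 = N + y'" "\<rho> 0 < N" "\<rho> 3 < N"
      by (metis le_Suc_ex)
    have "({\<rho> 0, N + y}, {\<rho> 0, N + y'}) \<in> eorder ?G"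
      using ord'[OF pe(1) _ _ pe(2)] y by (simp add: insert_commute)
    moreover have "({\<rho> 0, N + y'}, {\<rho> 3, N + y}) \<in> eorder ?G"
      using ord'[OF pe(2) _ _ pe(5)] y by (simp add: insert_commute T_def)
    ultimately have "y \<le> y'" "y' \<le> y"
      using y(3,4) by (auto simp: eorder_bipartite_graph_iff)
    then show False using f_neq[of 0 1] y by (simp add: \<kappa>_def)
  qed
  have \<rho>_ends: "\<rho> 0 \<ge> N" "\<rho> (T + 1) \<ge> N"
    using \<kappa>_0 sides[OF pe(1)] sides[OF pe(3)] by auto
  then have \<kappa>_lt: "\<kappa> 0 < N" "\<kappa> 1 < N" "\<kappa> 2 < N"
    using \<kappa>_0 sides[OF pe(2)] sides[OF pe(4)] by auto
  have \<kappa>_N: "\<kappa> c < N" if "c < 3" for c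
  proof -
    have "c \<in> {0, 1, 2}" using that by auto
    then show ?thesis using \<kappa>_lt by auto
  qed
  have col: "\<exists>c<3. pattern_edge T c r" if r: "r \<le> T + 1" for r
  proof -
    consider "r = 0" | "r = T + 1" | "1 \<le> r" "r \<le> T" using r by linarith
    then show ?thesis
    proof cases
      case 3
      then show ?thesis by (intro exI[of _ "r mod 3"]) (simp add: pe(6))
    qed (use pe(1,3) in \<open>auto intro!: exI[of _ 0]\<close>)
  qed
  define y where "y r = \<rho> r - N" for r
  have \<rho>: "\<rho> r = N + y r" if "r \<le> T + 1" for r
    using col[OF that] sides[of _ r] \<kappa>_N that by (fastforce simp: y_def)
  have adj: "host_edge K q b (\<kappa> c) (y r)" if "pattern_edge T c r" "c < 3" "r \<le> T + 1" for c r
    using edge'[OF that] \<kappa>_N[OF that(2)] \<rho>[OF that(3)] by (simp add: edge_bipartite_graph_iff)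
  have mono: "y r \<le> y r'" if r: "r \<le> r'" "r' \<le> T + 1" for r r'
  proof (cases "r = r'")
    case False
    obtain c c' where c: "c < 3" "pattern_edge T c r" "c' < 3" "pattern_edge T c' r'"
      using col[of r] col[of r'] r by auto
    then have "({\<kappa> c, N + y r}, {\<kappa> c', N + y r'}) \<in> eorder ?G"
      using ord'[of c r c' r'] \<rho> r False by simp
    then show ?thesis using \<kappa>_N c by (auto simp: eorder_bipartite_graph_iff)
  qed simp
  define B where "B = K * (K * q)"
  \<comment> \<open>Downward induction from the leading coordinate: \<open>y r div B ^ i\<close>
    collects the coordinates from \<open>i\<close> on. It is 0 for \<open>i = b\<close> and
    \<open>y r\<close> itself for \<open>i = 0\<close>.\<close>
  have all_eq: "\<forall>r\<le>T + 1. y r div B ^ i = y 0 div B ^ i" if "i \<le> b" for i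
    using that
  proof (induction rule: inc_induct)
    case base
    have "y r div B ^ b = 0" if "r \<le> T + 1" for r
      using col[OF that] adj that by (auto simp: host_edge_def B_def)
    then show ?case by simp
  next
    case (step i)
    define d where "d r = digit B i (y r)" for r
    have div_eq: "y r div B ^ i = B * (y 0 div B ^ Suc i) + d r" if "r \<le> T + 1" for r
      using step.IH that div_power_Suc_digit[of "y r" B i] unfolding d_def by metis
    \<comment> \<open>Since the higher coordinates already agree, monotonicity of \<open>y\<close>
      passes to the current digit.\<close>
    have d_mono: "d r \<le> d r'" if "r \<le> r'" "r' \<le> T + 1" for r r'
      using div_le_mono[OF mono[OF that], of "B ^ i"] div_eq[of r] div_eq[of r'] that by simp
    \<comment> \<open>The rows \<open>3 * s\<close> are leaves at the left vertex 0;
      \<open>T\<close> is chosen to supply \<open>K + 1\<close> of them, one more than there are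
      residues.\<close>
    have "\<not> inj_on (\<lambda>s. d (3 * s) mod K) {1..K + 1}"
    proof
      assume "inj_on (\<lambda>s. d (3 * s) mod K) {1..K + 1}"
      then have "card {1..K + 1} \<le> card {..<K}"
        by (rule card_inj_on_le) (use \<open>K > 0\<close> in auto)
      then show False by simp
    qed
    then obtain s s' where s: "s < s'" "1 \<le> s" "s' \<le> K + 1" "d (3 * s) mod K = d (3 * s') mod K"
      unfolding inj_on_def by (metis atLeastAtMost_iff linorder_neqE_nat)
    have "host_edge K q b (\<kappa> 0) (y (3 * s))" "host_edge K q b (\<kappa> 0) (y (3 * s'))"
      using s by (auto intro!: adj simp: pattern_edge_def T_def)
    then have eq: "d (3 * s) = d (3 * s')"
      using host_edge_digit_eq[of K q b "\<kappa> 0" "y (3 * s)" "y (3 * s')" i] s(4) step.hyps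
      by (simp add: d_def B_def)
    have block: "d r = d (3 * s)" if "3 * s \<le> r" "r \<le> 3 * s'" for r
      using d_mono[of "3 * s" r] d_mono[of r "3 * s'"] that eq s by (simp add: T_def)
    \<comment> \<open>As \<open>s < s'\<close>, the block contains three successive rows, one
      attached to each left vertex.\<close>
    have "(3 * s + 1) mod 3 = 1" "(3 * s + 2) mod 3 = 2" by presburger+
    then have "pattern_edge T 0 (3 * s)" "pattern_edge T 1 (3 * s + 1)" "pattern_edge T 2 (3 * s + 2)"
      using pe(6)[of "3 * s"] pe(6)[of "3 * s + 1"] pe(6)[of "3 * s + 2"] s(1-3) by (simp_all add: T_def)
    then have nb: "host_edge K q b (\<kappa> 0) (y (3 * s))" "host_edge K q b (\<kappa> 1) (y (3 * s + 1))"
      "host_edge K q b (\<kappa> 2) (y (3 * s + 2))"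
      using s(1-3) by (simp_all add: adj T_def)
    have bl: "d (3 * s + 1) = d (3 * s)" "d (3 * s + 2) = d (3 * s)"
      using block[of "3 * s + 1"] block[of "3 * s + 2"] s(1) by simp_all
    have "d 0 = d (3 * s)"
    proof (rule ccontr)
      \<comment> \<open>Otherwise \<open>\<kappa> 0\<close> and \<open>\<kappa> 1\<close> would
        share the neighbour \<open>y 0\<close> and also the block value, a second point in
        coordinate \<open>i\<close>.\<close>
      assume "d 0 \<noteq> d (3 * s)"
      then have "\<kappa> 0 = \<kappa> 1"
        using host_edge_unique[of K q b "\<kappa> 0" "y 0" "y (3 * s)" "\<kappa> 1" "y (3 * s + 1)" i]
          nb adj[OF pe(1)] adj[OF pe(2)] bl step.hyps by (simp add: d_def B_def)
      then show False using f_neq[of 0 1] by (simp add: \<kappa>_def)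
    qed
    moreover have "d (T + 1) = d (3 * s)"
    proof (rule ccontr)
      assume "d (T + 1) \<noteq> d (3 * s)"
      then have "\<kappa> 0 = \<kappa> 2"
        using host_edge_unique[of K q b "\<kappa> 0" "y (T + 1)" "y (3 * s)" "\<kappa> 2" "y (3 * s + 2)" i]
          nb adj[OF pe(3)] adj[OF pe(4)] bl step.hyps by (simp add: d_def B_def)
      then show False using f_neq[of 0 2] by (simp add: \<kappa>_def)
    qed
    ultimately have "d r = d 0" if "r \<le> T + 1" for r
      using d_mono[of 0 r] d_mono[of r "T + 1"] that by simp
    then have "y r div B ^ i = y 0 div B ^ i" if "r \<le> T + 1" for r
      using div_eq[OF that] div_eq[OF le0] that by metis
    then show ?case by blast
  qed
  have "y (T + 1) = y 0" using all_eq[OF le0, THEN spec, of "T + 1"] by simp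
  then show False using f_neq[of 3 "3 + (T + 1)"] \<rho>[of 0] \<rho>[of "T + 1"] by (simp add: \<rho>_def)
qed

subsection \<open>The lower bound\<close>

text \<open>Since \<open>(1 + 1 / q) ^ m\<close> is at most \<open>exp (m / q)\<close>, hence at
  most \<open>exp 1\<close>, taking the largest admissible integer \<open>q\<close> costs only a
  factor 3.\<close>

lemma real_Suc_power_le:
  assumes "q \<ge> m"
  shows "real (Suc q) ^ m \<le> 3 * real q ^ m"
proof (cases "q = 0")
  case False
  have "(1 + 1 / real q) ^ m \<le> exp (1 / real q) ^ m"
    by (intro power_mono exp_ge_add_one_self) simp
  also have "exp (1 / real q) ^ m = exp (real m / real q)"
    by (simp flip: exp_of_nat_mult)
  also have "\<dots> \<le> exp 1"
    using assms False by simp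
  also have "\<dots> \<le> 3" by (rule exp_le)
  finally have "real q ^ m * (1 + 1 / real q) ^ m \<le> real q ^ m * 3"
    by (intro mult_left_mono) auto
  moreover have "real (Suc q) ^ m = real q ^ m * (1 + 1 / real q) ^ m"
    using False by (simp add: field_simps flip: power_mult_distrib)
  ultimately show ?thesis by simp
qed (use assms in simp)

lemma ex_max_nat:
  fixes P :: "nat \<Rightarrow> bool"
  assumes "P a" "\<And>x. P x \<Longrightarrow> x \<le> u"
  obtains m where "P m" "\<not> P (Suc m)"
  using assms by (metis GreatestI_nat Greatest_le_nat Suc_n_not_le_n)

text \<open>The slopes and intercepts range over \<open>q \<ge> K ^ (2 * b)\<close> values, which makes the left class the
  larger one. The choice of \<open>b\<close> and \<open>q\<close> as large as possible loses only constant factors.\<close>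

lemma ex_lt_pattern_tree_ge:
  assumes K: "K \<ge> 2" and n: "n \<ge> 2"
  obtains b where "n < 2 * K ^ (2 * (b + 1) * (b + 2))"
    and "real n * real K ^ b \<le> 6 * real (ex_lt n (pattern_tree (3 * (K + 1))))"
proof -
  \<comment> \<open>The exponent makes \<open>q = K ^ (2 * b)\<close> satisfy
    \<open>2 * q ^ (b + 1) \<le> n\<close>. The factor 2 reserves half of the vertices for the right
    class.\<close>
  have "\<exists>b. 2 * K ^ (2 * b * (b + 1)) \<le> n \<and> \<not> 2 * K ^ (2 * Suc b * (Suc b + 1)) \<le> n"
  proof (rule ex_max_nat[where P = "\<lambda>b. 2 * K ^ (2 * b * (b + 1)) \<le> n" and a = 0 and u = n])
    fix b assume "2 * K ^ (2 * b * (b + 1)) \<le> n"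
    moreover have "b < 2 ^ b" by simp
    moreover have "(2 :: nat) ^ b \<le> K ^ b" using K by (simp add: power_mono)
    moreover have "K ^ b \<le> K ^ (2 * b * (b + 1))" using K by (intro power_increasing) auto
    ultimately show "b \<le> n" by linarith
  qed (use n in auto)
  then obtain b where b: "2 * K ^ (2 * b * (b + 1)) \<le> n" "n < 2 * K ^ (2 * (b + 1) * (b + 2))"
    by (auto simp: not_le)
  have "\<exists>q. (K ^ (2 * b) \<le> q \<and> 2 * q ^ (b + 1) \<le> n) \<and> \<not> (K ^ (2 * b) \<le> Suc q \<and> 2 * Suc q ^ (b + 1) \<le> n)"
  proof (rule ex_max_nat[where P = "\<lambda>q. K ^ (2 * b) \<le> q \<and> 2 * q ^ (b + 1) \<le> n" and a = "K ^ (2 * b)" and u = n])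
    show "K ^ (2 * b) \<le> K ^ (2 * b) \<and> 2 * (K ^ (2 * b)) ^ (b + 1) \<le> n"
      using b(1) by (simp only: power_mult[symmetric]) simp
    fix q assume "K ^ (2 * b) \<le> q \<and> 2 * q ^ (b + 1) \<le> n"
    moreover have "q \<le> q ^ (b + 1)" by (cases "q = 0") auto
    ultimately show "q \<le> n" by linarith
  qed blast
  then obtain q where q: "K ^ (2 * b) \<le> q" "2 * q ^ (b + 1) \<le> n" "n < 2 * Suc q ^ (b + 1)"
    by (metis le_SucI not_le)
  have "b < 2 ^ b" by simp
  also have "(2 :: nat) ^ b \<le> K ^ (2 * b)"
    using K power_mono[of 2 K b] power_increasing[of b "2 * b" K] by linarith
  finally have bq: "b + 1 \<le> q" using q(1) by linarith
  \<comment> \<open>The bound \<open>q \<ge> K ^ (2 * b)\<close> makes the right class no larger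
    than the left one.\<close>
  have "(K * (K * q)) ^ b = K ^ (2 * b) * q ^ b"
    by (simp add: power_mult_distrib power_mult power2_eq_square mult.assoc)
  also have "\<dots> \<le> q ^ (b + 1)" using q(1) by simp
  finally have size: "q ^ (b + 1) + (K * (K * q)) ^ b \<le> n" using q(2) by linarith
  let ?G = "bipartite_graph (q ^ (b + 1)) n (host_edge K q b)"
  have "q ^ (b + 1) * K ^ b = card (edges ?G)"
    using card_edges_host[OF _ _ size] K bq by simp
  also have "\<dots> \<le> ex_lt n (pattern_tree (3 * (K + 1)))"
    using K by (intro ex_lt_ge edge_ordered_bipartite_graph host_avoids_pattern) auto
  finally have "real q ^ (b + 1) * real K ^ b \<le> real (ex_lt n (pattern_tree (3 * (K + 1))))"
    by (metis of_nat_le_iff of_nat_mult of_nat_power)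
  moreover have "real n \<le> 6 * real q ^ (b + 1)"
  proof -
    have "real n \<le> real (2 * Suc q ^ (b + 1))" using q(3) by (simp only: of_nat_le_iff)
    also have "\<dots> \<le> 2 * (3 * real q ^ (b + 1))"
      using real_Suc_power_le[OF bq] unfolding of_nat_mult of_nat_power by linarith
    finally show ?thesis by simp
  qed
  then have "real n * real K ^ b \<le> 6 * (real q ^ (b + 1) * real K ^ b)"
    by (simp add: mult_right_mono mult.assoc[symmetric])
  ultimately show ?thesis using that[OF b(2)] by linarith
qed

theorem theorem1p13:
  fixes C :: real
  assumes "C > 0"
  shows "\<exists>H :: nat eograph. edge_ordered_tree H \<and> order_chromatic_number H = 2 \<and>
    (\<exists>c::real. c > 0 \<and> (\<exists>n0::nat. \<forall>n\<ge>n0.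
      real (ex_lt n H) \<ge> c * (real n * 2 powr (C * sqrt (log 2 (real n))))))"
proof -
  \<comment> \<open>This choice ensures \<open>C * sqrt (2 * s) \<le> s\<close>, where
    \<open>s\<close> is the binary logarithm of \<open>K\<close>.\<close>
  obtain s :: nat where s: "2 * C\<^sup>2 \<le> real s"
    using real_arch_simple by blast
  moreover have "0 < 2 * C\<^sup>2" using assms by simp
  ultimately have "s > 0" by linarith
  define K where "K = (2 :: nat) ^ s"
  have K: "K \<ge> 2" using \<open>s > 0\<close> power_increasing[of 1 s "2 :: nat"] by (simp add: K_def)
  define T where "T = 3 * (K + 1)"
  let ?H = "pattern_tree T"
  have "{0, 3 + 0} \<in> edges ?H"
    by (subst edge_bipartite_graph_iff) (auto simp: pattern_edge_def)
  then have "order_chromatic_number ?H = 2"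
    by (intro order_chromatic_number_bipartite_graph) blast
  moreover have "edge_ordered_tree ?H"
    using is_tree_pattern_tree[of T] edge_ordered_bipartite_graph
    by (simp add: edge_ordered_tree_def T_def)
  \<comment> \<open>The 6 comes from rounding \<open>q\<close>; \<open>K ^ 2\<close> pays for
    passing from exponent \<open>b\<close> to \<open>b + 2\<close>.\<close>
  moreover have "1 / (6 * real K ^ 2) * (real n * 2 powr (C * sqrt (log 2 (real n)))) \<le> real (ex_lt n ?H)"
    if n: "n \<ge> 2" for n
  proof -
    obtain b where b: "n < 2 * K ^ (2 * (b + 1) * (b + 2))" "real n * real K ^ b \<le> 6 * real (ex_lt n ?H)"
      using ex_lt_pattern_tree_ge[OF K n] unfolding T_def by blast
    have "n < 2 ^ (1 + s * (2 * (b + 1) * (b + 2)))"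
      using b(1) by (simp only: K_def power_Suc plus_1_eq_Suc power_mult[of "2 :: nat" s])
    \<comment> \<open>Completing to a square makes \<open>sqrt (log 2 n)\<close> at most
      \<open>sqrt (2 * s) * (b + 2)\<close>; the slack \<open>2 * s * (b + 2)\<close> absorbs the
      1.\<close>
    also have "\<dots> \<le> 2 ^ (2 * s * (b + 2)\<^sup>2)"
    proof (intro power_increasing)
      have "1 + s * (2 * (b + 1) * (b + 2)) \<le> s * (2 * (b + 2)) + s * (2 * (b + 1) * (b + 2))"
        using \<open>s > 0\<close> by simp
      also have "\<dots> = 2 * s * (b + 2)\<^sup>2" by (simp add: power2_eq_square algebra_simps)
      finally show "1 + s * (2 * (b + 1) * (b + 2)) \<le> 2 * s * (b + 2)\<^sup>2" .
    qed simp
    finally have "real n \<le> 2 ^ (2 * s * (b + 2)\<^sup>2)"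
      by (metis less_imp_le of_nat_le_iff of_nat_numeral of_nat_power)
    then have "real n \<le> 2 powr real (2 * s * (b + 2)\<^sup>2)"
      by (simp only: powr_realpow zero_less_numeral)
    then have "log 2 (real n) \<le> real (2 * s * (b + 2)\<^sup>2)"
      using n log_le_iff[of 2 "real n"] by simp
    then have "C * sqrt (log 2 (real n)) \<le> C * sqrt (real (2 * s * (b + 2)\<^sup>2))"
      using assms by simp
    also have "\<dots> = (C * sqrt (2 * real s)) * real (b + 2)"
      by (simp add: real_sqrt_mult)
    also have "\<dots> \<le> real s * real (b + 2)"
    proof (intro mult_right_mono)
      have "(C * sqrt (2 * real s))\<^sup>2 = 2 * C\<^sup>2 * real s"
        by (simp add: power_mult_distrib)
      also have "\<dots> \<le> (real s)\<^sup>2" using s by (simp add: power2_eq_square mult_right_mono)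
      finally show "C * sqrt (2 * real s) \<le> real s" by (rule power2_le_imp_le) simp
    qed simp
    finally have "2 powr (C * sqrt (log 2 (real n))) \<le> 2 powr real (s * (b + 2))"
      by (simp add: distrib_left mult.commute)
    also have "\<dots> = real K ^ (b + 2)"
      by (simp only: powr_realpow zero_less_numeral K_def power_mult of_nat_power of_nat_numeral)
    finally have "real n * 2 powr (C * sqrt (log 2 (real n))) \<le> real n * real K ^ (b + 2)"
      by (intro mult_left_mono) auto
    also have "\<dots> = real n * real K ^ b * real K ^ 2"
      by (simp only: power_add mult.assoc)
    also have "\<dots> \<le> 6 * real (ex_lt n ?H) * real K ^ 2"
      using b(2) by (intro mult_right_mono) auto
    finally show ?thesis using K by (simp add: field_simps)
  qed
  moreover have "1 / (6 * real K ^ 2) > 0" using K by simp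
  ultimately show ?thesis by blast
qed

end
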